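(* Let $n\ge 3$ and let $\mathbb{K}$ be a field of characteristic zero. The category $\mathbf{U}_n(\mathbf{Lb})$ is not a full subcategory of ${}_n\mathbf{Lb}$; that is, there exist finite-dimensional Leibniz algebras $\mathfrak{L},\mathfrak{L}'$ over $\mathbb{K}$ and a homomorphism of Leibniz $n$-algebras $\mathbf{U}_n(\mathfrak{L})\to\mathbf{U}_n(\mathfrak{L}')$ which is not a homomorphism of Leibniz algebras $\mathfrak{L}\to\mathfrak{L}'$.
   Context: $\mathbf{Lb}$ is the category of Leibniz algebras: vector spaces with a bilinear bracket satisfying $[[x,y],z]=[[x,z],y]+[x,[y,z]]$. ${}_n\mathbf{Lb}$ is the category of Leibniz $n$-algebras: vector spaces with an $n$-linear bracket satisfying $[[x_1,\ldots,x_n],y_1,\ldots,y_{n-1}]=\sum_{i=1}^{n}[x_1,\ldots,x_{i-1},[x_i,y_1,\ldots,y_{n-1}],x_{i+1},\ldots,x_n]$. In both categories morphisms are the linear maps preserving the bracket. The functor $\mathbf{U}_n:\mathbf{Lb}\to{}_n\mathbf{Lb}$ sends $\mathfrak{L}$ to the same vector space with bracket $[x_1,\dots,x_n]=[x_1,[\dots,[x_{n-2},[x_{n-1},x_n]]\dots]]$ and is the identity on underlying linear maps; $\mathbf{U}_n(\mathbf{Lb})$ denotes its image, with objects $\mathbf{U}_n(\mathfrak{L})$ and morphisms the Leibniz algebra homomorphisms. *)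

theory Defs
  imports "Jordan_Normal_Form.Missing_VectorSpace"
begin

definition char_zero :: "('a, 'm) ring_scheme \<Rightarrow> bool" where
  "char_zero K \<longleftrightarrow> (\<forall>m::nat. 0 < m \<longrightarrow> [m] \<cdot>\<^bsub>K\<^esub> \<one>\<^bsub>K\<^esub> \<noteq> \<zero>\<^bsub>K\<^esub>)"

text \<open>
  The record \<^typ>\<open>('a, 'v) module\<close> extends the ring record, so it has fields for a product and a
  unit on the vectors; as elsewhere for modules, these are ignored.  The brackets are separate
  fields.
\<close>

record ('a, 'v) leibniz = "('a, 'v) module" +
  bracket :: "'v \<Rightarrow> 'v \<Rightarrow> 'v"

locale leibniz_algebra = vectorspace K L
  for K :: "('a, 'm) ring_scheme" and L :: "('a, 'v, 'e) leibniz_scheme" +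
  assumes bracket_linear_left:
      "y \<in> carrier L \<Longrightarrow> linear_map K L L (\<lambda>x. bracket L x y)"
    and bracket_linear_right:
      "x \<in> carrier L \<Longrightarrow> linear_map K L L (\<lambda>y. bracket L x y)"
    and leibniz_identity:
      "\<lbrakk>x \<in> carrier L; y \<in> carrier L; z \<in> carrier L\<rbrakk> \<Longrightarrow>
        bracket L (bracket L x y) z =
          bracket L (bracket L x z) y \<oplus>\<^bsub>L\<^esub> bracket L x (bracket L y z)"

locale leibniz_hom = source: leibniz_algebra K L + target: leibniz_algebra K L' + linear_map K L L' f
  for K :: "('a, 'm) ring_scheme" and L :: "('a, 'v, 'e) leibniz_scheme"
    and L' :: "('a, 'w, 'e') leibniz_scheme" and f :: "'v \<Rightarrow> 'w" +
  assumes hom_bracket: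
    "\<lbrakk>x \<in> carrier L; y \<in> carrier L\<rbrakk> \<Longrightarrow> f (bracket L x y) = bracket L' (f x) (f y)"

definition tuples :: "nat \<Rightarrow> 'v set \<Rightarrow> 'v list set" where
  "tuples n V = {xs. length xs = n \<and> set xs \<subseteq> V}"

text \<open>An \<open>n\<close>-ary bracket takes the list of its arguments; only lists in \<^term>\<open>tuples n V\<close> matter.\<close>

record ('a, 'v) n_leibniz = "('a, 'v) module" +
  nbracket :: "'v list \<Rightarrow> 'v"

locale n_leibniz_algebra = vectorspace K A
  for n :: nat and K :: "('a, 'm) ring_scheme" and A :: "('a, 'v, 'e) n_leibniz_scheme" +
  assumes nbracket_multilinear:
      "\<lbrakk>xs \<in> tuples n (carrier A); i < n\<rbrakk> \<Longrightarrow> linear_map K A A (\<lambda>x. nbracket A (xs[i := x]))"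
    and n_leibniz_identity:
      "\<lbrakk>xs \<in> tuples n (carrier A); ys \<in> tuples (n - 1) (carrier A)\<rbrakk> \<Longrightarrow>
        nbracket A (nbracket A xs # ys) =
          (\<Oplus>\<^bsub>A\<^esub>i\<in>{..<n}. nbracket A (xs[i := nbracket A ((xs ! i) # ys)]))"

locale n_leibniz_hom =
    source: n_leibniz_algebra n K A + target: n_leibniz_algebra n K B + linear_map K A B f
  for n :: nat and K :: "('a, 'm) ring_scheme" and A :: "('a, 'v, 'e) n_leibniz_scheme"
    and B :: "('a, 'w, 'e') n_leibniz_scheme" and f :: "'v \<Rightarrow> 'w" +
  assumes hom_nbracket:
    "xs \<in> tuples n (carrier A) \<Longrightarrow> f (nbracket A xs) = nbracket B (map f xs)"

fun right_nested :: "('v \<Rightarrow> 'v \<Rightarrow> 'v) \<Rightarrow> 'v list \<Rightarrow> 'v" where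
  "right_nested b [] = undefined"
| "right_nested b [x] = x"
| "right_nested b (x # y # zs) = b x (right_nested b (y # zs))"

definition U :: "nat \<Rightarrow> ('a, 'v) leibniz \<Rightarrow> ('a, 'v) n_leibniz" where
  "U n L =
    \<lparr>carrier = carrier L, mult = mult L, one = one L, zero = zero L, add = add L, smult = smult L,
     nbracket = restrict (right_nested (bracket L)) (tuples n (carrier L))\<rparr>"

text \<open>
  The objects \<open>U n L\<close> of the subcategory are indexed by the Leibniz algebras \<open>L\<close>, and its morphisms
  \<open>U n L \<rightarrow> U n L'\<close> are the homomorphisms \<open>L \<rightarrow> L'\<close>.  Algebras whose vectors are of type \<open>'v\<close> are
  considered.
\<close>

definition U_Lb_full :: "nat \<Rightarrow> ('a, 'm) ring_scheme \<Rightarrow> 'v itself \<Rightarrow> bool" where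
  "U_Lb_full n K _ \<longleftrightarrow>
    (\<forall>(L :: ('a, 'v) leibniz) (L' :: ('a, 'v) leibniz) f.
      leibniz_algebra K L \<longrightarrow> leibniz_algebra K L' \<longrightarrow>
      n_leibniz_hom n K (U n L) (U n L') f \<longrightarrow> leibniz_hom K L L' f)"

end

theory Submission
  imports Defs
begin

text \<open>
  For \<open>n \<ge> 3\<close> the \<open>n\<close>-bracket of \<open>U n L\<close> applies the binary bracket at least twice, one
  application inside the right argument of another.  It therefore retains nothing of a bracket that
  satisfies \<open>[x, [y, z]] = 0\<close> for all \<open>x\<close>, \<open>y\<close>, \<open>z\<close>: the \<open>n\<close>-bracket is then identically
  zero (\<open>nbracket_U_zero\<close>), and every linear map between two algebras of this kind is a
  homomorphism of Leibniz \<open>n\<close>-algebras (\<open>linear_map_n_leibniz_hom\<close>).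

  It remains to find two such algebras on one finite-dimensional space, one with a nonzero bracket
  and the other abelian, since the identity map then fails to preserve the binary bracket.  The
  plane with basis \<open>e\<^sub>0\<close>, \<open>e\<^sub>1\<close>, where \<open>[e\<^sub>0, e\<^sub>0] = e\<^sub>1\<close> and all other brackets of basis
  vectors vanish, is the smallest choice: on a line, \<open>[e, e] = c e\<close> forces \<open>c\<^sup>2 = 2 c\<^sup>2\<close> by the
  Leibniz identity for \<open>e\<close>, \<open>e\<close>, \<open>e\<close>, hence \<open>c = 0\<close>.
\<close>

lemma linear_mapI:
  assumes "vectorspace K V" "vectorspace K W" "T \<in> carrier V \<rightarrow> carrier W"
    and "\<And>x y. \<lbrakk>x \<in> carrier V; y \<in> carrier V\<rbrakk> \<Longrightarrow> T (x \<oplus>\<^bsub>V\<^esub> y) = T x \<oplus>\<^bsub>W\<^esub> T y"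
    and "\<And>c x. \<lbrakk>c \<in> carrier K; x \<in> carrier V\<rbrakk> \<Longrightarrow> T (c \<odot>\<^bsub>V\<^esub> x) = c \<odot>\<^bsub>W\<^esub> T x"
  shows "linear_map K V W T"
  using assms
  by (auto simp: linear_map_def mod_hom_def mod_hom_axioms_def module_hom_def vectorspace_def)

text \<open>This carries the vector space structure between records with different brackets.\<close>

lemma vectorspace_cong:
  assumes "vectorspace K V"
    and "carrier W = carrier V" "add W = add V" "zero W = zero V" "smult W = smult V"
  shows "vectorspace K W"
proof -
  interpret V: vectorspace K V by fact
  have "module K W"
    by (rule module_criteria)
      (use assms V.a_assoc V.a_comm V.r_neg in
        \<open>auto simp: V.R.is_cring V.smult_assoc1 V.smult_l_distr V.smult_r_distr
          V.M.add.m_ac intro!: bexI[of _ "\<ominus>\<^bsub>V\<^esub> _"]\<close>)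
  then show ?thesis
    by (simp add: vectorspace_def V.field_axioms)
qed

context leibniz_algebra
begin

lemma bracket_closed: "\<lbrakk>x \<in> carrier L; y \<in> carrier L\<rbrakk> \<Longrightarrow> bracket L x y \<in> carrier L"
  using bracket_linear_left[of y] by (auto simp: linear_map_def intro: mod_hom.f_im)

lemma right_nested_closed:
  "\<lbrakk>set xs \<subseteq> carrier L; xs \<noteq> []\<rbrakk> \<Longrightarrow> right_nested (bracket L) xs \<in> carrier L"
  by (induction "bracket L" xs rule: right_nested.induct) (auto intro: bracket_closed)

end

lemma U_simps [simp]:
  "carrier (U n L) = carrier L" "add (U n L) = add L" "zero (U n L) = zero L"
  "smult (U n L) = smult L"
  "xs \<in> tuples n (carrier L) \<Longrightarrow> nbracket (U n L) xs = right_nested (bracket L) xs"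
  by (simp_all add: U_def)

text \<open>
  With \<open>n \<ge> 3\<close> arguments the bracket has the form \<open>[x, [y, w]]\<close>, where \<open>w\<close> is the nested bracket
  of the remaining ones; this includes the case of a single remaining argument \<open>w\<close>.
\<close>

lemma nbracket_U_zero:
  fixes L :: "('a, 'v) leibniz"
  assumes "leibniz_algebra K L" and "n \<ge> 3"
    and nil: "\<And>x y z. \<lbrakk>x \<in> carrier L; y \<in> carrier L; z \<in> carrier L\<rbrakk> \<Longrightarrow>
      bracket L x (bracket L y z) = \<zero>\<^bsub>L\<^esub>"
    and xs: "xs \<in> tuples n (carrier L)"
  shows "nbracket (U n L) xs = \<zero>\<^bsub>L\<^esub>"
proof -
  interpret leibniz_algebra K L by fact
  obtain x y z zs where [simp]: "xs = x # y # z # zs"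
    using xs \<open>n \<ge> 3\<close> by (auto simp: tuples_def numeral_3_eq_3 Suc_le_length_iff)
  have "right_nested (bracket L) (z # zs) \<in> carrier L"
    using xs by (intro right_nested_closed) (auto simp: tuples_def)
  then show ?thesis
    using xs nil by (simp add: tuples_def)
qed

text \<open>
  The zero map is multilinear, and every term of the \<open>n\<close>-ary identity is a value of the
  vanishing \<open>n\<close>-bracket.
\<close>

lemma n_leibniz_algebra_U:
  fixes L :: "('a, 'v) leibniz"
  assumes L: "leibniz_algebra K L" and n: "n \<ge> 3"
    and nil: "\<And>x y z. \<lbrakk>x \<in> carrier L; y \<in> carrier L; z \<in> carrier L\<rbrakk> \<Longrightarrow>
      bracket L x (bracket L y z) = \<zero>\<^bsub>L\<^esub>"
  shows "n_leibniz_algebra n K (U n L)"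
proof -
  interpret leibniz_algebra K L by fact
  note zero = nbracket_U_zero[OF L n nil]
  have U: "vectorspace K (U n L)"
    by (rule vectorspace_cong[OF vectorspace_axioms]) simp_all
  then interpret U: vectorspace K "U n L" .
  have update: "xs[i := x] \<in> tuples n (carrier L)"
    if "xs \<in> tuples n (carrier L)" "x \<in> carrier L" for xs i x
    using that set_update_subset_insert[of xs i x] by (auto simp: tuples_def)
  show ?thesis
  proof (intro n_leibniz_algebra.intro U n_leibniz_algebra_axioms.intro)
    fix xs i assume "xs \<in> tuples n (carrier (U n L))"
    then show "linear_map K (U n L) (U n L) (\<lambda>x. nbracket (U n L) (xs[i := x]))"
      by (intro linear_mapI U) (simp_all add: update zero del: U_simps(5))
  next
    fix xs ys
    assume xs: "xs \<in> tuples n (carrier (U n L))" and ys: "ys \<in> tuples (n - 1) (carrier (U n L))"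
    have Cons: "x # ys \<in> tuples n (carrier L)" if "x \<in> carrier L" for x
      using that ys n by (auto simp: tuples_def)
    have "nbracket (U n L) (xs[i := nbracket (U n L) (xs ! i # ys)]) = \<zero>\<^bsub>L\<^esub>" if "i < n" for i
    proof -
      have "xs ! i \<in> carrier L"
        using xs that by (auto simp: tuples_def)
      then show ?thesis
        using xs by (simp add: zero Cons update del: U_simps(5))
    qed
    then have "(\<Oplus>\<^bsub>U n L\<^esub>i\<in>{..<n}. nbracket (U n L) (xs[i := nbracket (U n L) (xs ! i # ys)]))
        = (\<Oplus>\<^bsub>U n L\<^esub>i\<in>{..<n}. \<zero>\<^bsub>U n L\<^esub>)"
      by (intro U.finsum_cong') auto
    then show "nbracket (U n L) (nbracket (U n L) xs # ys) =
        (\<Oplus>\<^bsub>U n L\<^esub>i\<in>{..<n}. nbracket (U n L) (xs[i := nbracket (U n L) (xs ! i # ys)]))"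
      using xs by (simp add: zero Cons del: U_simps(5))
  qed
qed

text \<open>Both \<open>n\<close>-brackets vanish, so preserving them only asks that \<open>0\<close> be sent to \<open>0\<close>.\<close>

lemma linear_map_n_leibniz_hom:
  fixes L :: "('a, 'v) leibniz" and L' :: "('a, 'w) leibniz"
  assumes L: "leibniz_algebra K L" and L': "leibniz_algebra K L'" and n: "n \<ge> 3"
    and nil: "\<And>x y z. \<lbrakk>x \<in> carrier L; y \<in> carrier L; z \<in> carrier L\<rbrakk> \<Longrightarrow>
      bracket L x (bracket L y z) = \<zero>\<^bsub>L\<^esub>"
    and nil': "\<And>x y z. \<lbrakk>x \<in> carrier L'; y \<in> carrier L'; z \<in> carrier L'\<rbrakk> \<Longrightarrow>
      bracket L' x (bracket L' y z) = \<zero>\<^bsub>L'\<^esub>"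
    and f: "linear_map K L L' f"
  shows "n_leibniz_hom n K (U n L) (U n L') f"
proof -
  interpret f: linear_map K L L' f by fact
  interpret S: n_leibniz_algebra n K "U n L"
    by (rule n_leibniz_algebra_U[OF L n nil])
  interpret T: n_leibniz_algebra n K "U n L'"
    by (rule n_leibniz_algebra_U[OF L' n nil'])
  interpret Uf: linear_map K "U n L" "U n L'" f
    by (rule linear_mapI) (simp_all add: S.vectorspace_axioms T.vectorspace_axioms)
  show ?thesis
  proof
    fix xs assume xs: "xs \<in> tuples n (carrier (U n L))"
    then have "map f xs \<in> tuples n (carrier L')"
      by (auto simp: tuples_def)
    with xs show "f (nbracket (U n L) xs) = nbracket (U n L') (map f xs)"
      by (simp add: nbracket_U_zero[OF L n nil] nbracket_U_zero[OF L' n nil'] del: U_simps(5))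
  qed
qed

text \<open>
  With \<open>e\<^sub>0\<close>, \<open>e\<^sub>1\<close> the standard basis of \<open>K\<^sup>2\<close>, the bracket is \<open>[x, y] = a x\<^sub>0 y\<^sub>0 e\<^sub>1\<close>.  The
  parameter \<open>a\<close> treats the abelian algebra (\<open>a = 0\<close>) and the nonabelian one (\<open>a = 1\<close>) together.
\<close>

definition plane :: "('a, 'm) ring_scheme \<Rightarrow> 'a \<Rightarrow> ('a, nat \<Rightarrow> 'a) leibniz" where
  "plane K a = module.extend (ring.func_space K {0, 1}) (leibniz.fields
    (\<lambda>x y. \<lambda>i\<in>{0, 1}. if i = 0 then \<zero>\<^bsub>K\<^esub> else a \<otimes>\<^bsub>K\<^esub> (x 0 \<otimes>\<^bsub>K\<^esub> y 0)))"

context field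
begin

lemma plane_simps:
  "carrier (plane R a) = {0, 1} \<rightarrow>\<^sub>E carrier R"
  "x \<oplus>\<^bsub>plane R a\<^esub> y = (\<lambda>i\<in>{0, 1}. x i \<oplus> y i)"
  "\<zero>\<^bsub>plane R a\<^esub> = (\<lambda>i\<in>{0, 1}. \<zero>)"
  "c \<odot>\<^bsub>plane R a\<^esub> x = (\<lambda>i\<in>{0, 1}. c \<otimes> x i)"
  "bracket (plane R a) x y = (\<lambda>i\<in>{0, 1}. if i = 0 then \<zero> else a \<otimes> (x 0 \<otimes> y 0))"
  by (simp_all add: plane_def func_space_def module.defs leibniz.defs)

lemma vectorspace_plane: "vectorspace R (plane R a)"
proof (rule vectorspace_cong)
  show "vectorspace R (func_space {0::nat, 1})"
    by (simp add: vectorspace_def func_space_is_module field_axioms)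
qed (simp_all add: plane_def func_space_def module.defs leibniz.defs)

lemma fin_dim_plane: "vectorspace.fin_dim R (plane R a)"
proof -
  interpret V: vectorspace R "plane R a" by (rule vectorspace_plane)
  define e where "e j = (\<lambda>i\<in>{0, 1 :: nat}. if i = j then \<one> else \<zero>)" for j
  have e: "{e 0, e 1} \<subseteq> carrier (plane R a)"
    by (auto simp: e_def plane_simps)
  interpret S: submodule R "V.span {e 0, e 1}" "plane R a"
    using e by (rule V.span_is_submodule)
  have "x \<in> V.span {e 0, e 1}" if x: "x \<in> carrier (plane R a)" for x
  proof -
    have coord: "x 0 \<in> carrier R" "x 1 \<in> carrier R"
      using x by (auto simp: plane_simps)
    then have "x = (x 0 \<odot>\<^bsub>plane R a\<^esub> e 0) \<oplus>\<^bsub>plane R a\<^esub> (x 1 \<odot>\<^bsub>plane R a\<^esub> e 1)"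
      using x by (auto simp: plane_simps e_def fun_eq_iff PiE_def extensional_def)
    moreover have "e j \<in> V.span {e 0, e 1}" if "j \<in> {0, 1}" for j
      using that V.in_own_span[OF e] by auto
    ultimately show ?thesis
      using coord S.m_closed S.smult_closed by (metis insertI1 insertI2)
  qed
  then have "V.gen_set {e 0, e 1}"
    using V.span_is_subset2[OF e] by auto
  with e show ?thesis
    unfolding V.fin_dim_def by (intro exI[of _ "{e 0, e 1}"]) simp
qed

text \<open>The bracket depends only on the coordinates at \<open>0\<close>, and its values have coordinate \<open>0\<close> there.\<close>

lemma bracket_plane_nested:
  assumes "a \<in> carrier R" and "x \<in> carrier (plane R a)"
  shows "bracket (plane R a) x (bracket (plane R a) y z) = \<zero>\<^bsub>plane R a\<^esub>"
proof -
  have "x 0 \<in> carrier R"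
    using assms by (auto simp: plane_simps)
  with assms(1) show ?thesis
    by (simp add: plane_simps fun_eq_iff)
qed


lemma leibniz_algebra_plane:
  assumes "a \<in> carrier R"
  shows "leibniz_algebra R (plane R a)"
  using assms
  by (intro leibniz_algebra.intro vectorspace_plane leibniz_algebra_axioms.intro linear_mapI)
    (simp_all add: plane_simps PiE_iff fun_eq_iff l_distr r_distr m_ac)

lemma linear_map_plane_id: "linear_map R (plane R a) (plane R a') (\<lambda>x. x)"
  by (intro linear_mapI vectorspace_plane) (auto simp: plane_simps)

end

theorem mainTheorem8:
  fixes K :: "('a, 'm) ring_scheme" and n :: nat
  assumes "n \<ge> 3" and "field K" and "char_zero K"
  shows "\<not> U_Lb_full n K TYPE(nat \<Rightarrow> 'a) \<and>
    (\<exists>(L :: ('a, nat \<Rightarrow> 'a) leibniz) (L' :: ('a, nat \<Rightarrow> 'a) leibniz) f.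
      leibniz_algebra K L \<and> vectorspace.fin_dim K L \<and>
      leibniz_algebra K L' \<and> vectorspace.fin_dim K L' \<and>
      n_leibniz_hom n K (U n L) (U n L') f \<and>
      \<not> leibniz_hom K L L' f)"
proof -
  interpret field K by fact
  let ?L = "plane K \<one>\<^bsub>K\<^esub>" and ?L' = "plane K \<zero>\<^bsub>K\<^esub>"
  have n_hom: "n_leibniz_hom n K (U n ?L) (U n ?L') (\<lambda>x. x)"
    using \<open>n \<ge> 3\<close>
    by (intro linear_map_n_leibniz_hom leibniz_algebra_plane bracket_plane_nested
        linear_map_plane_id) auto
  have not_hom: "\<not> leibniz_hom K ?L ?L' (\<lambda>x. x)"
  proof
    assume "leibniz_hom K ?L ?L' (\<lambda>x. x)"
    then interpret leibniz_hom K ?L ?L' "\<lambda>x. x" .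
    \<comment> \<open>the coordinate of \<open>[e\<^sub>0, e\<^sub>0]\<close> at \<open>1\<close> is \<open>1\<close> in \<open>?L\<close> and \<open>0\<close> in \<open>?L'\<close>\<close>
    let ?e = "\<lambda>i\<in>{0, 1 :: nat}. if i = 0 then \<one>\<^bsub>K\<^esub> else \<zero>\<^bsub>K\<^esub>"
    have "?e \<in> carrier ?L"
      by (auto simp: plane_simps)
    then have "bracket ?L ?e ?e 1 = bracket ?L' ?e ?e 1"
      using hom_bracket[of ?e ?e] by simp
    then show False
      by (simp add: plane_simps)
  qed
  show ?thesis
    unfolding U_Lb_full_def
    using n_hom not_hom leibniz_algebra_plane[OF one_closed] leibniz_algebra_plane[OF zero_closed]
      fin_dim_plane by blast
qed

end
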